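(* Let $j \ge k$ be positive integers. For any ditree $T$, we have $\vec{\lambda}_{j,k}(T) \le \min\{2j, j+2k\}$. Moreover, $\vec{\lambda}_{j,k}(T) = \min\{2j, j+2k\}$ if $T$ has a dipath of length $4$.
   Context: All digraphs are finite and strongly simple: they have no loops, no multiple edges, and never contain both edges $xy$ and $yx$. A ditree is an orientation of a (finite) tree, i.e. a digraph obtained from a tree by assigning one direction to each edge. In a digraph $D$, $xy\in E(D)$ denotes an edge directed from $x$ to $y$, and then $x$ is adjacent to $y$. A dipath of length $\ell$ is a sequence of $\ell+1$ distinct vertices $v_0,v_1,\dots,v_\ell$ with $v_iv_{i+1}\in E(D)$ for all $0\le i<\ell$. The distance $d_D(x,y)$ is the length of a shortest dipath from $x$ to $y$ (if one exists). For positive integers $j\ge k$, an $L(j,k)$-labeling of $D$ is a function $f$ from $V(D)$ to the nonnegative integers such that $|f(x)-f(y)|\ge j$ whenever $xy\in E(D)$ and $|f(x)-f(y)|\ge k$ whenever $d_D(x,y)=2$. The number $\vec{\lambda}_{j,k}(D)$ is the minimum, over all $L(j,k)$-labelings $f$ of $D$, of the span of $f$ (largest label minus smallest label). Equivalently, it is the minimum over all $L(j,k)$-labelings of the maximum label used. *)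

theory Defs
  imports "Graph_Theory.Graph_Theory"
begin

locale strongly_simple_digraph = digraph +
  assumes no_opposite_arcs: "u \<rightarrow>\<^bsub>G\<^esub> v \<Longrightarrow> \<not> v \<rightarrow>\<^bsub>G\<^esub> u"

text \<open>
  Undirected graphs are symmetric digraphs. The library predicate \<open>tree\<close> is not usable here: its
  \<open>forest\<close> forbids only directed cycles, so it admits every connected acyclic digraph and, since
  \<open>a, b, a\<close> counts as a cycle, rejects every symmetric digraph with an edge. In a symmetric loopfree
  digraph the cycles of length at least 3 are exactly the cycles of the undirected graph.
\<close>
definition undirected_tree :: "'a pair_pre_digraph \<Rightarrow> bool" where
  "undirected_tree H \<longleftrightarrow> pair_graph H \<and> connected H
     \<and> \<not> (\<exists>p. pre_digraph.cycle H p \<and> 3 \<le> length p)"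

locale ditree = strongly_simple_digraph +
  assumes underlying_tree: "undirected_tree (mk_symmetric G)"

text \<open>The value is \<open>\<infinity>\<close> if \<open>y\<close> is not reachable from \<open>x\<close>.\<close>
definition didist :: "('a, 'b) pre_digraph \<Rightarrow> 'a \<Rightarrow> 'a \<Rightarrow> ereal" where
  "didist D x y = wf_digraph.\<mu> D (\<lambda>_. 1) x y"

definition L_labeling :: "nat \<Rightarrow> nat \<Rightarrow> ('a, 'b) pre_digraph \<Rightarrow> ('a \<Rightarrow> nat) \<Rightarrow> bool" where
  "L_labeling j k D f \<longleftrightarrow>
     (\<forall>x \<in> verts D. \<forall>y \<in> verts D.
        (x \<rightarrow>\<^bsub>D\<^esub> y \<longrightarrow> \<bar>int (f x) - int (f y)\<bar> \<ge> int j) \<and>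
        (didist D x y = 2 \<longrightarrow> \<bar>int (f x) - int (f y)\<bar> \<ge> int k))"

definition label_span :: "('a, 'b) pre_digraph \<Rightarrow> ('a \<Rightarrow> nat) \<Rightarrow> nat" where
  "label_span D f = Max (f ` verts D) - Min (f ` verts D)"

definition L_number :: "nat \<Rightarrow> nat \<Rightarrow> ('a, 'b) pre_digraph \<Rightarrow> nat" where
  "L_number j k D = (LEAST s. \<exists>f. L_labeling j k D f \<and> label_span D f = s)"

text \<open>
  \<open>\<mu>\<close> ranges over walks; with unit weights it is the length of a shortest path.
\<close>
lemma (in wf_digraph) awalk_cost_unit: "awalk_cost (\<lambda>_. 1) p = real (length p)"
  by (induction p) auto

lemma (in wf_digraph) didist_eq_INF_apath:
  "didist G x y = (INF p\<in>{p. apath x p y}. ereal (real (length p)))"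
proof -
  have "(INF p\<in>{p. awalk x p y}. ereal (real (length p)))
      = (INF p\<in>{p. apath x p y}. ereal (real (length p)))"
  proof (rule antisym)
    show "(INF p\<in>{p. awalk x p y}. ereal (real (length p)))
        \<le> (INF p\<in>{p. apath x p y}. ereal (real (length p)))"
      by (rule INF_superset_mono) (auto simp: apath_def)
    show "(INF p\<in>{p. apath x p y}. ereal (real (length p)))
        \<le> (INF p\<in>{p. awalk x p y}. ereal (real (length p)))"
    proof (rule INF_greatest)
      fix p assume "p \<in> {p. awalk x p y}"
      then have w: "awalk x p y" by simp
      have "length (awalk_to_apath p) \<le> length p"
        using awalk_to_path_no_neg_cyc_cost[OF w, of "\<lambda>_. 1"] by (simp add: awalk_cost_unit)
      with apath_awalk_to_apath[OF w]
      show "(INF p\<in>{p. apath x p y}. ereal (real (length p))) \<le> ereal (real (length p))"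
        by (intro INF_lower2[of "awalk_to_apath p"]) auto
    qed
  qed
  then show ?thesis
    by (simp add: didist_def \<mu>_def awalk_cost_unit)
qed

text \<open>
  On a finite loopfree digraph the minimum in \<open>L_number\<close> is over a nonempty set.
\<close>
lemma (in digraph) L_labeling_exists: "\<exists>f. L_labeling j k G f"
proof -
  obtain g :: "'a \<Rightarrow> nat" where g: "inj_on g (verts G)"
    using finite_imp_inj_to_nat_seg[OF finite_verts] by metis
  have far: "int (j + k) \<le> \<bar>int ((j + k) * g x) - int ((j + k) * g y)\<bar>"
    if "x \<in> verts G" "y \<in> verts G" "x \<noteq> y" for x y
  proof -
    have "g x \<noteq> g y" using g that by (auto dest: inj_onD)
    then have "1 \<le> \<bar>int (g x) - int (g y)\<bar>" by auto
    then have "int (j + k) * 1 \<le> int (j + k) * \<bar>int (g x) - int (g y)\<bar>"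
      by (intro mult_left_mono) auto
    also have "\<dots> = \<bar>int ((j + k) * g x) - int ((j + k) * g y)\<bar>"
      by (simp add: abs_mult flip: right_diff_distrib)
    finally show ?thesis by simp
  qed
  have "didist G x x \<noteq> 2" if "x \<in> verts G" for x
  proof -
    have "didist G x x \<le> 0"
      using that unfolding didist_eq_INF_apath
      by (intro INF_lower2[of "[]"]) (auto simp: apath_Nil_iff)
    then show ?thesis by auto
  qed
  then have "L_labeling j k G (\<lambda>x. (j + k) * g x)"
    unfolding L_labeling_def using far adj_not_same by fastforce
  then show ?thesis by blast
qed

lemma (in digraph) L_number_attained:
  "\<exists>f. L_labeling j k G f \<and> label_span G f = L_number j k G"
  unfolding L_number_def by (rule LeastI_ex) (use L_labeling_exists in blast)

end

theory Submission
  imports Defs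
begin

text \<open>
  Both bounds come from one fact about a ditree: its vertices carry an integer level that rises by
  exactly one along every arc. The level is a potential: give each arc of the underlying tree the
  weight \<open>1\<close> in the direction of the digraph and \<open>-1\<close> against it; a closed walk in a tree
  runs through each edge equally often in both directions, so its weight is \<open>0\<close>
  (\<open>sum_closed_walk_eq_0\<close>), and the weight of a walk depends on its ends only
  (\<open>ex_potential\<close>).

  For the upper bound, composing the level with an \<open>L(j,k)\<close>-labeling of the two-way infinite dipath
  \<open>\<int>\<close> labels the ditree, as vertices at distance two have levels that differ by two. Periodic
  labelings of \<open>\<int>\<close> with the patterns \<open>0, j, 2j\<close> and \<open>0, j+k, k, j+2k\<close> give the two
  terms of the minimum.

  For the lower bound, the level shows that vertices two steps apart on a dipath really are at
  distance two, so on a dipath of length 4 four conditions with \<open>j\<close> and three with \<open>k\<close> apply. A span below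
  \<open>2j\<close> excludes three successive monotone labels, hence the five labels zigzag: two peaks
  among three valleys, or the reverse. The descent of \<open>j\<close> from the lower peak and the gaps \<open>k\<close>
  between the peaks and between its two valleys add up to a span of at least \<open>j+2k\<close>
  (\<open>five_labels_spread\<close>).
\<close>

section \<open>Levels\<close>

text \<open>
  Excluding cycles of length at least 3 leaves back-and-forth pairs of arcs as the only cycles, and
  these have weight \<open>0\<close>. A closed walk that is not a cycle repeats a vertex apart from
  its common start and end, and splits there into two shorter closed walks.
\<close>
lemma (in pair_loopfree_digraph) sum_closed_walk_eq_0:
  fixes w :: "'a \<times> 'a \<Rightarrow> 'b :: ab_group_add"
  assumes no_long_cycle: "\<And>p. cycle p \<Longrightarrow> length p < 3"
    and antisym: "\<And>u v. (u, v) \<in> parcs G \<Longrightarrow> w (v, u) = - w (u, v)"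
    and "awalk u p u"
  shows "sum_list (map w p) = 0"
  using \<open>awalk u p u\<close>
proof (induction "length p" arbitrary: u p rule: less_induct)
  case less
  show ?case
  proof (cases p)
    case Nil
    then show ?thesis by simp
  next
    case (Cons e p')
    obtain v where e: "e = (u, v)" "(u, v) \<in> parcs G" and p': "awalk v p' u"
      using less.prems Cons by (cases e) (auto simp: awalk_Cons_iff)
    show ?thesis
    proof (cases "distinct (pawalk_verts v p')")
      case True
      then have "cycle p"
        using less.prems Cons e unfolding cycle_def by auto
      then have "length p' < 2"
        using no_long_cycle Cons by fastforce
      moreover have "p' \<noteq> []"
        using p' e pair_no_loops[of "(u, v)"] by (auto simp: awalk_Nil_iff)
      ultimately obtain e' where "p' = [e']"
        by (cases p') auto
      then have "p' = [(v, u)]"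
        using p' by (cases e') (auto simp: awalk_simps)
      then show ?thesis
        using Cons e antisym by simp
    next
      case False
      then obtain q r s x where p'_eq: "p' = q @ r @ s" and "r \<noteq> []"
        and walks: "awalk v q x" "awalk x r x" "awalk x s u"
        using awalk_not_distinct_decomp[OF p'] by auto
      have "sum_list (map w r) = 0"
        using less.hyps[OF _ walks(2)] Cons p'_eq by simp
      moreover have shortcut: "awalk u (e # q @ s) u"
        using walks e by (auto simp: awalk_Cons_iff in_arcsD1)
      have "sum_list (map w (e # q @ s)) = 0"
        by (rule less.hyps[OF _ shortcut]) (use Cons p'_eq \<open>r \<noteq> []\<close> in simp)
      ultimately show ?thesis
        using Cons p'_eq by (simp add: algebra_simps)
    qed
  qed
qed

text \<open>
  The potential of a vertex is the weight of some walk to it from a root. Comparing the walks to two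
  adjacent vertices needs no reversal: both are closed up by one walk back to the root.
\<close>
lemma (in wf_digraph) ex_potential:
  fixes w :: "'b \<Rightarrow> 'c :: ab_group_add"
  assumes "strongly_connected G"
    and closed: "\<And>u p. awalk u p u \<Longrightarrow> sum_list (map w p) = 0"
  obtains h where "\<And>e. e \<in> arcs G \<Longrightarrow> h (head G e) = h (tail G e) + w e"
proof -
  obtain a where a: "a \<in> verts G"
    using assms(1) by (auto simp: strongly_connected_def)
  have walk: "\<exists>p. awalk x p y" if "x \<in> verts G" "y \<in> verts G" for x y
    using assms(1) that by (auto simp: strongly_connected_def reachable_awalk)
  define path where "path v = (SOME p. awalk a p v)" for v
  have path: "awalk a (path v) v" if "v \<in> verts G" for v
    unfolding path_def using walk[OF a that] by (rule someI_ex)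
  show thesis
  proof (rule that)
    fix e assume e: "e \<in> arcs G"
    then obtain r where r: "awalk (head G e) r a"
      using walk[OF head_in_verts a] by blast
    have "awalk a (path (tail G e) @ e # r) a"
      using path[OF tail_in_verts[OF e]] r e by (auto simp: awalk_Cons_iff)
    moreover have "awalk a (path (head G e) @ r) a"
      using path[OF head_in_verts[OF e]] r by auto
    ultimately have "sum_list (map w (path (tail G e) @ e # r))
        = sum_list (map w (path (head G e) @ r))"
      using closed by metis
    then show "sum_list (map w (path (head G e))) = sum_list (map w (path (tail G e))) + w e"
      by (simp add: algebra_simps)
  qed
qed

lemma (in ditree) ex_level:
  obtains h :: "'a \<Rightarrow> int" where "\<And>u v. u \<rightarrow>\<^bsub>G\<^esub> v \<Longrightarrow> h v = h u + 1"
proof -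
  let ?H = "mk_symmetric G"
  let ?w = "\<lambda>(u, v). if u \<rightarrow>\<^bsub>G\<^esub> v then 1 else - 1 :: int"
  interpret H: pair_graph ?H
    using underlying_tree by (simp add: undirected_tree_def)
  have arcs_H: "(u, v) \<in> parcs ?H \<longleftrightarrow> u \<rightarrow>\<^bsub>G\<^esub> v \<or> v \<rightarrow>\<^bsub>G\<^esub> u" for u v
    by (auto simp: parcs_mk_symmetric arcs_ends_conv)
  have closed: "sum_list (map ?w p) = 0" if "H.awalk u p u" for u p
  proof (rule H.sum_closed_walk_eq_0[OF _ _ that])
    show "length p < 3" if "H.cycle p" for p
      using underlying_tree that by (auto simp: undirected_tree_def not_le)
    show "?w (v, u) = - ?w (u, v)" if "(u, v) \<in> parcs ?H" for u v
      using that no_opposite_arcs by (auto simp: arcs_H)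
  qed
  have "strongly_connected ?H"
    using H.symmetric_connected_imp_strongly_connected[OF symmetric_mk_symmetric] underlying_tree
    by (simp add: undirected_tree_def)
  then obtain h where h: "\<And>e. e \<in> parcs ?H \<Longrightarrow> h (snd e) = h (fst e) + ?w e"
    using H.ex_potential[of ?w] closed by auto
  show thesis
  proof (rule that)
    show "h v = h u + 1" if "u \<rightarrow>\<^bsub>G\<^esub> v" for u v
      using h[of "(u, v)"] that by (simp add: arcs_H)
  qed
qed

lemma (in wf_digraph) length_walk_eq_level_diff:
  fixes h :: "'a \<Rightarrow> int"
  assumes level: "\<And>u v. u \<rightarrow>\<^bsub>G\<^esub> v \<Longrightarrow> h v = h u + 1"
    and "awalk x p y"
  shows "int (length p) = h y - h x"
  using \<open>awalk x p y\<close>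
proof (induction p arbitrary: x)
  case Nil
  then show ?case by (simp add: awalk_Nil_iff)
next
  case (Cons e p)
  then have "h (head G e) = h x + 1"
    by (intro level) (auto simp: awalk_Cons_iff intro: in_arcs_imp_in_arcs_ends)
  with Cons show ?case
    by (fastforce simp: awalk_Cons_iff)
qed

text \<open>Levels fix the length of all walks between two vertices, so a single walk gives the distance.\<close>
lemma (in wf_digraph) didist_eq_level_diff:
  fixes h :: "'a \<Rightarrow> int"
  assumes level: "\<And>u v. u \<rightarrow>\<^bsub>G\<^esub> v \<Longrightarrow> h v = h u + 1"
    and "awalk x p y"
  shows "didist G x y = ereal (real_of_int (h y - h x))"
proof -
  have "real (length q) = real_of_int (h y - h x)" if "awalk x q y" for q
    using length_walk_eq_level_diff[of h, OF level that] by (metis of_int_of_nat_eq)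
  then have "didist G x y = (INF q\<in>{q. awalk x q y}. ereal (real_of_int (h y - h x)))"
    unfolding didist_def \<mu>_def awalk_cost_unit by (intro INF_cong) auto
  also have "\<dots> = ereal (real_of_int (h y - h x))"
    using assms(2) by (intro INF_const) auto
  finally show ?thesis .
qed

lemma (in wf_digraph) level_diff_eq_2:
  fixes h :: "'a \<Rightarrow> int"
  assumes level: "\<And>u v. u \<rightarrow>\<^bsub>G\<^esub> v \<Longrightarrow> h v = h u + 1"
    and "didist G x y = 2"
  shows "h y = h x + 2"
proof -
  have "didist G x y \<noteq> \<infinity>"
    using assms(2) by simp
  then have "x \<rightarrow>\<^sup>* y"
    using shortest_path_inf unfolding didist_def by blast
  then obtain p where "awalk x p y"
    by (auto simp: reachable_awalk)
  then have "ereal (real_of_int (h y - h x)) = 2"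
    using didist_eq_level_diff[OF level] assms(2) by simp
  then show ?thesis
    by (metis diff_eq_eq add.commute ereal.inject numeral_eq_ereal of_int_eq_iff of_int_numeral)
qed

section \<open>Upper bound\<close>

lemma (in digraph) L_number_le:
  assumes "L_labeling j k G f" and "verts G \<noteq> {}" and "\<And>v. v \<in> verts G \<Longrightarrow> f v \<le> B"
  shows "L_number j k G \<le> B"
proof -
  have "L_number j k G \<le> label_span G f"
    unfolding L_number_def using assms(1) by (intro Least_le) blast
  also have "\<dots> \<le> Max (f ` verts G)"
    by (simp add: label_span_def)
  also have "\<dots> \<le> B"
    using assms(2,3) by simp
  finally show ?thesis .
qed

text \<open>The premises on \<open>g\<close> say that it is an \<open>L(j,k)\<close>-labeling of the dipath \<open>\<int>\<close>.\<close>
lemma (in ditree) L_number_le_integer_labeling: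
  fixes g :: "int \<Rightarrow> nat"
  assumes g1: "\<And>i. \<bar>int (g i) - int (g (i + 1))\<bar> \<ge> int j"
    and g2: "\<And>i. \<bar>int (g i) - int (g (i + 2))\<bar> \<ge> int k"
    and "\<And>i. g i \<le> B"
  shows "L_number j k G \<le> B"
proof -
  obtain h :: "'a \<Rightarrow> int" where level: "\<And>u v. u \<rightarrow>\<^bsub>G\<^esub> v \<Longrightarrow> h v = h u + 1"
    using ex_level by blast
  have "L_labeling j k G (g \<circ> h)"
    using g1 g2 level level_diff_eq_2[of h, OF level] by (auto simp: L_labeling_def)
  moreover have "verts G \<noteq> {}"
    using underlying_tree by (auto simp: undirected_tree_def connected_def strongly_connected_def)
  ultimately show ?thesis
    using assms(3) by (intro L_number_le) auto
qed

lemma (in ditree) L_number_le_2j: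
  assumes "k \<le> j"
  shows "L_number j k G \<le> 2 * j"
proof (rule L_number_le_integer_labeling)
  let ?g = "\<lambda>i :: int. nat (i mod 3) * j"
  have succ: "(i + 1) mod 3 = (i mod 3 + 1) mod 3" "(i + 2) mod 3 = (i mod 3 + 2) mod 3" for i :: int
    by (simp_all add: mod_simps)
  have "i mod 3 \<in> {0..<3}" for i :: int
    by simp
  then have cases: "i mod 3 = 0 \<or> i mod 3 = 1 \<or> i mod 3 = 2" for i :: int
    by fastforce
  show "\<bar>int (?g i) - int (?g (i + 1))\<bar> \<ge> int j" for i
    using cases[of i] unfolding succ[of i] by (elim disjE; simp)
  show "\<bar>int (?g i) - int (?g (i + 2))\<bar> \<ge> int k" for i
    using cases[of i] assms unfolding succ[of i] by (elim disjE; simp)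
  show "?g i \<le> 2 * j" for i
    using cases[of i] by (elim disjE; simp)
qed

lemma (in ditree) L_number_le_j_plus_2k: "L_number j k G \<le> j + 2 * k"
proof (rule L_number_le_integer_labeling)
  let ?g = "\<lambda>i :: int. [0, j + k, k, j + 2 * k] ! nat (i mod 4)"
  have succ: "(i + 1) mod 4 = (i mod 4 + 1) mod 4" "(i + 2) mod 4 = (i mod 4 + 2) mod 4" for i :: int
    by (simp_all add: mod_simps)
  have "i mod 4 \<in> {0..<4}" for i :: int
    by simp
  then have cases: "i mod 4 = 0 \<or> i mod 4 = 1 \<or> i mod 4 = 2 \<or> i mod 4 = 3" for i :: int
    by fastforce
  show "\<bar>int (?g i) - int (?g (i + 1))\<bar> \<ge> int j" for i
    using cases[of i] unfolding succ[of i] by (elim disjE; simp)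
  show "\<bar>int (?g i) - int (?g (i + 2))\<bar> \<ge> int k" for i
    using cases[of i] unfolding succ[of i] by (elim disjE; simp)
  show "?g i \<le> j + 2 * k" for i
    using cases[of i] by (elim disjE; simp)
qed

section \<open>Lower bound\<close>

text \<open>
  Since \<open>s < 2j\<close> the labels zigzag, with peaks \<open>b\<close>, \<open>d\<close> and valleys \<open>a\<close>, \<open>c\<close>, \<open>e\<close>. Both
  neighbours of the lower peak are valleys at least \<open>j\<close> below it, the deeper of them at least
  \<open>j + k\<close> below; the higher peak adds another \<open>k\<close>.
\<close>
lemma five_labels_spread_rising:
  fixes a b c d e j k s :: int
  assumes adjacent: "j \<le> \<bar>a - b\<bar>" "j \<le> \<bar>b - c\<bar>" "j \<le> \<bar>c - d\<bar>" "j \<le> \<bar>d - e\<bar>"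
    and distance_two: "k \<le> \<bar>a - c\<bar>" "k \<le> \<bar>b - d\<bar>" "k \<le> \<bar>c - e\<bar>"
    and within: "\<And>x y. x \<in> {a, b, c, d, e} \<Longrightarrow> y \<in> {a, b, c, d, e} \<Longrightarrow> x - y \<le> s"
    and "s < 2 * j" and "a \<le> b"
  shows "j + 2 * k \<le> s"
proof -
  have le: "b - a \<le> s" "b - c \<le> s" "b - d \<le> s" "b - e \<le> s" "c - a \<le> s" "d - a \<le> s" "d - c \<le> s"
    "d - e \<le> s" "e - c \<le> s"
    by (intro within; simp)+
  have ab: "a \<le> b - j"
    using adjacent(1) \<open>a \<le> b\<close> le(1) \<open>s < 2 * j\<close> by linarith
  have cb: "c \<le> b - j"
    using adjacent(2) ab le(5) \<open>s < 2 * j\<close> by linarith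
  have cd: "c \<le> d - j"
    using adjacent(3) cb le(3) \<open>s < 2 * j\<close> by linarith
  have ed: "e \<le> d - j"
    using adjacent(4) cd le(9) \<open>s < 2 * j\<close> by linarith
  show ?thesis
  proof (cases "b \<le> d")
    case True
    then show ?thesis
      using distance_two(1,2) ab cb le(6,7) by linarith
  next
    case False
    then show ?thesis
      using distance_two(2,3) cd ed le(2,4) by linarith
  qed
qed

lemma five_labels_spread:
  fixes a b c d e j k s :: int
  assumes adjacent: "j \<le> \<bar>a - b\<bar>" "j \<le> \<bar>b - c\<bar>" "j \<le> \<bar>c - d\<bar>" "j \<le> \<bar>d - e\<bar>"
    and distance_two: "k \<le> \<bar>a - c\<bar>" "k \<le> \<bar>b - d\<bar>" "k \<le> \<bar>c - e\<bar>"
    and within: "\<And>x y. x \<in> {a, b, c, d, e} \<Longrightarrow> y \<in> {a, b, c, d, e} \<Longrightarrow> x - y \<le> s"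
  shows "min (2 * j) (j + 2 * k) \<le> s"
proof (cases "s < 2 * j")
  case True
  have "j + 2 * k \<le> s"
  proof (cases "a \<le> b")
    case rising: True
    show ?thesis
      by (rule five_labels_spread_rising[OF adjacent distance_two within True rising])
  next
    case falling: False
    have negated: "x - y \<le> s" if "x \<in> {- a, - b, - c, - d, - e}" "y \<in> {- a, - b, - c, - d, - e}"
      for x y
      using within[of "- y" "- x"] that by auto
    show ?thesis
      by (rule five_labels_spread_rising[of j "- a" "- b" "- c" "- d" "- e",
            OF _ _ _ _ _ _ _ negated True])
        (use adjacent distance_two falling in \<open>simp_all add: abs_minus_commute\<close>)
  qed
  then show ?thesis by simp
qed simp

lemma (in digraph) label_diff_le_span:
  assumes "x \<in> verts G" and "y \<in> verts G"
  shows "int (f x) - int (f y) \<le> int (label_span G f)"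
proof -
  have "f x \<le> Max (f ` verts G)" "Min (f ` verts G) \<le> f y"
    using assms by auto
  then show ?thesis
    by (simp add: label_span_def)
qed

lemma (in ditree) L_number_ge_if_walk_of_length_4:
  assumes "awalk u p v" and "length p = 4"
  shows "min (2 * j) (j + 2 * k) \<le> L_number j k G"
proof -
  obtain h :: "'a \<Rightarrow> int" where level: "\<And>u v. u \<rightarrow>\<^bsub>G\<^esub> v \<Longrightarrow> h v = h u + 1"
    using ex_level by blast
  obtain f where f: "L_labeling j k G f" "label_span G f = L_number j k G"
    using L_number_attained by blast
  obtain e1 e2 e3 e4 where p: "p = [e1, e2, e3, e4]"
    using assms(2) by (auto simp: eval_nat_numeral length_Suc_conv)
  define b c d where "b = head G e1" and "c = head G e2" and "d = head G e3"
  have steps: "awalk u [e1] b" "awalk b [e2] c" "awalk c [e3] d" "awalk d [e4] v"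
    using assms(1) by (auto simp: p b_def c_def d_def awalk_simps)
  have verts: "{u, b, c, d, v} \<subseteq> verts G"
    using steps by (auto dest: awalk_hd_in_verts awalk_last_in_verts)
  have one: "int j \<le> \<bar>int (f x) - int (f y)\<bar>" if "awalk x [e] y" for x e y
  proof -
    have "x \<rightarrow>\<^bsub>G\<^esub> y"
      using that by (auto simp: awalk_simps intro: in_arcs_imp_in_arcs_ends)
    then show ?thesis
      using f(1) by (auto simp: L_labeling_def dest: adj_in_verts)
  qed
  have two: "int k \<le> \<bar>int (f x) - int (f z)\<bar>" if "awalk x [e] y" "awalk y [e'] z" for x e y e' z
  proof -
    have walk: "awalk x [e, e'] z"
      using awalk_appendI[OF that] by simp
    then have "h z - h x = 2"
      using length_walk_eq_level_diff[of h, OF level walk] by simp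
    then have "didist G x z = 2"
      using didist_eq_level_diff[of h, OF level walk] by simp
    then show ?thesis
      using f(1) walk by (auto simp: L_labeling_def dest: awalk_hd_in_verts awalk_last_in_verts)
  qed
  have within: "x - y \<le> int (L_number j k G)"
    if "x \<in> {int (f u), int (f b), int (f c), int (f d), int (f v)}"
      and "y \<in> {int (f u), int (f b), int (f c), int (f d), int (f v)}" for x y
  proof -
    have "x \<in> (\<lambda>z. int (f z)) ` verts G" "y \<in> (\<lambda>z. int (f z)) ` verts G"
      using that verts by auto
    then show ?thesis
      using label_diff_le_span[of _ _ f] f(2) by fastforce
  qed
  have "min (2 * int j) (int j + 2 * int k) \<le> int (L_number j k G)"
    by (rule five_labels_spread[OF steps[THEN one] two[OF steps(1,2)] two[OF steps(2,3)]
          two[OF steps(3,4)] within])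
  then show ?thesis
    by linarith
qed

theorem theorem9:
  fixes T :: "('a, 'b) pre_digraph" and j k :: nat
  assumes "1 \<le> k" and "k \<le> j"
    and "ditree T"
  shows "L_number j k T \<le> min (2 * j) (j + 2 * k) \<and>
    ((\<exists>u p v. pre_digraph.apath T u p v \<and> length p = 4) \<longrightarrow>
       L_number j k T = min (2 * j) (j + 2 * k))"
proof -
  interpret ditree T by fact
  have "L_number j k T \<le> min (2 * j) (j + 2 * k)"
    using L_number_le_2j[OF \<open>k \<le> j\<close>] L_number_le_j_plus_2k by simp
  moreover have "min (2 * j) (j + 2 * k) \<le> L_number j k T" if "apath u p v" "length p = 4" for u p v
    using L_number_ge_if_walk_of_length_4 that by (blast dest: awalkI_apath)
  ultimately show ?thesis
    by (blast intro: antisym)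
qed

end
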